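(* There exists a family $\{(G_J,S_J): J\in 2^{\mathbb N}\}$ of $4$-generated marked groups, indexed by all subsets $J$ of $\mathbb N$, satisfying the following: (strict monotonicity) for all $J\subsetneq J'$ there is a surjection of marked groups $G_{J'}\to G_J$ whose kernel is nonamenable; (continuity) for every sequence $\{J_n\subset J: n\in\mathbb N\}$ such that $J_n\to J$ in the Tychonoff topology of $2^{\mathbb N}$, we have $(G_{J_n},S_{J_n})\to(G_J,S_J)$ in the Chabauty topology.
   Context: A marked group $(G,S)$ is a group $G$ with an ordered finite symmetric generating set $S=\{s_1,\dots,s_k\}$, $S=S^{-1}$; equivalently an epimorphism $\mathbf F_k\to G$ from the free group sending the $i$-th free generator to $s_i$. It is $4$-generated if $k=4$. A homomorphism of marked groups sends the $i$-th generator to the $i$-th generator for each $i$. The Tychonoff topology on $2^{\mathbb N}$ (the set of subsets of $\mathbb N=\{1,2,\dots\}$) is the product topology: $J_n\to J$ iff for every $m$, $J_n\cap\{1,\dots,m\}=J\cap\{1,\dots,m\}$ for all large $n$. Marked groups $(G_n,S_n)$ converge to $(G,S)$ in the Chabauty topology if for every $r$, for all sufficiently large $n$ the balls of radius $r$ in $(G_n,S_n)$ and $(G,S)$ coincide, i.e. $\ker(\mathbf F_k\to G_n)$ and $\ker(\mathbf F_k\to G)$ have the same intersection with the ball of radius $r$ in $\mathbf F_k$. *)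

theory Defs
  imports "HOL-Algebra.Generated_Groups" "HOL-Analysis.Function_Topology"
begin

subsection \<open>Free groups\<close>

text \<open>The letter \<open>(i, True)\<close> stands for the \<open>i\<close>-th free generator and \<open>(i, False)\<close> for its
  inverse; generators are numbered from \<open>0\<close>. An element of the free group of rank \<open>k\<close> is
  represented by its unique reduced word.\<close>

type_synonym letter = "nat \<times> bool"

definition inv_letter :: "letter \<Rightarrow> letter" where
  "inv_letter x = (fst x, \<not> snd x)"

definition reduced :: "letter list \<Rightarrow> bool" where
  "reduced w \<longleftrightarrow> (\<forall>i. Suc i < length w \<longrightarrow> w ! Suc i \<noteq> inv_letter (w ! i))"

fun cancel_Cons :: "letter \<Rightarrow> letter list \<Rightarrow> letter list" where
  "cancel_Cons x [] = [x]"
| "cancel_Cons x (y # w) = (if y = inv_letter x then w else x # y # w)"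

definition free_group :: "nat \<Rightarrow> letter list monoid" where
  "free_group k =
    \<lparr>carrier = {w. reduced w \<and> fst ` set w \<subseteq> {..<k}}, mult = foldr cancel_Cons, one = []\<rparr>"

text \<open>On reduced words the word length of the free group is the length of the list.\<close>

definition free_ball :: "nat \<Rightarrow> nat \<Rightarrow> letter list set" where
  "free_ball k r = {w \<in> carrier (free_group k). length w \<le> r}"

lemma reduced_simps [simp]:
  "reduced []" "reduced [x]"
  "reduced (x # y # w) \<longleftrightarrow> y \<noteq> inv_letter x \<and> reduced (y # w)"
  by (auto simp: reduced_def nth_Cons split: nat.splits)

lemma inv_letter_simps [simp]:
  "inv_letter (inv_letter x) = x" "fst (inv_letter x) = fst x"
  "inv_letter x \<noteq> x" "x \<noteq> inv_letter x"
  by (auto simp: inv_letter_def prod_eq_iff)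

lemma reduced_ConsD: "reduced (x # w) \<Longrightarrow> reduced w"
  by (cases w) auto

lemma reduced_cancel_Cons: "reduced w \<Longrightarrow> reduced (cancel_Cons x w)"
  by (cases w) (auto dest: reduced_ConsD)

lemma cancel_Cons_inv:
  "reduced w \<Longrightarrow> cancel_Cons x (cancel_Cons (inv_letter x) w) = w"
  by (cases w rule: remdups_adj.cases) auto

lemma cancel_Cons_inv':
  "reduced w \<Longrightarrow> cancel_Cons (inv_letter x) (cancel_Cons x w) = w"
  using cancel_Cons_inv[of w "inv_letter x"] by simp

lemma cancel_Cons_reduced: "reduced (x # w) \<Longrightarrow> cancel_Cons x w = x # w"
  by (cases w) auto

lemma reduced_foldr: "reduced v \<Longrightarrow> reduced (foldr cancel_Cons u v)"
  by (induction u) (auto intro: reduced_cancel_Cons)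

lemma fst_set_cancel_Cons: "fst ` set (cancel_Cons x w) \<subseteq> insert (fst x) (fst ` set w)"
  by (cases w) auto

lemma fst_set_foldr: "fst ` set (foldr cancel_Cons u v) \<subseteq> fst ` set u \<union> fst ` set v"
proof (induction u)
  case (Cons x u)
  then show ?case
    using fst_set_cancel_Cons[of x "foldr cancel_Cons u v"]
    by (simp only: foldr.simps o_apply list.set image_insert) blast
qed simp

lemma foldr_cancel_Cons:
  assumes "reduced v"
  shows "foldr cancel_Cons (cancel_Cons x u) v = cancel_Cons x (foldr cancel_Cons u v)"
proof (cases u)
  case (Cons y u')
  then show ?thesis
    using cancel_Cons_inv[OF reduced_foldr[OF assms, of u'], of x] by auto
qed simp

lemma foldr_cancel_assoc:
  "reduced w \<Longrightarrow>
    foldr cancel_Cons (foldr cancel_Cons u v) w = foldr cancel_Cons u (foldr cancel_Cons v w)"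
  by (induction u) (auto simp: foldr_cancel_Cons)

lemma foldr_cancel_Nil: "reduced u \<Longrightarrow> foldr cancel_Cons u [] = u"
proof (induction u)
  case (Cons x u)
  then show ?case
    using cancel_Cons_reduced[OF Cons.prems] reduced_ConsD[OF Cons.prems] by simp
qed simp

lemma foldr_cancel_inv:
  "reduced w \<Longrightarrow> foldr cancel_Cons (rev (map inv_letter u)) (foldr cancel_Cons u w) = w"
  by (induction u) (auto simp: cancel_Cons_inv' reduced_foldr)

lemma group_free_group: "group (free_group k)"
proof (rule groupI)
  fix u assume u: "u \<in> carrier (free_group k)"
  let ?v = "foldr cancel_Cons (rev (map inv_letter u)) []"
  have "fst ` set ?v \<subseteq> fst ` set (rev (map inv_letter u))"
    using fst_set_foldr[of "rev (map inv_letter u)" "[]"] by simp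
  also have "\<dots> = fst ` set u"
    by force
  finally have "?v \<in> carrier (free_group k)"
    using u by (auto simp: free_group_def reduced_foldr)
  moreover have "?v \<otimes>\<^bsub>free_group k\<^esub> u = \<one>\<^bsub>free_group k\<^esub>"
    using u foldr_cancel_inv[of "[]" u]
    by (simp add: free_group_def foldr_cancel_assoc foldr_cancel_Nil del: rev_map)
  ultimately show "\<exists>v\<in>carrier (free_group k). v \<otimes>\<^bsub>free_group k\<^esub> u = \<one>\<^bsub>free_group k\<^esub>"
    by blast
qed (use fst_set_foldr in \<open>fastforce simp: free_group_def reduced_foldr foldr_cancel_assoc\<close>)+

subsection \<open>Marked groups\<close>

text \<open>A marking is a list because the generating set is ordered; it has no repetitions because it
  enumerates a set with \<open>k\<close> elements. A finitely generated group is countable, so up to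
  isomorphism every marked group has its carrier in \<open>nat\<close>.\<close>

definition marked_group :: "nat \<Rightarrow> 'a monoid \<Rightarrow> 'a list \<Rightarrow> bool" where
  "marked_group k G S \<longleftrightarrow>
    group G \<and> length S = k \<and> distinct S \<and> set S \<subseteq> carrier G \<and>
    m_inv G ` set S = set S \<and> generate G (set S) = carrier G"

definition marked_hom :: "'a monoid \<Rightarrow> 'a list \<Rightarrow> 'b monoid \<Rightarrow> 'b list \<Rightarrow> ('a \<Rightarrow> 'b) set" where
  "marked_hom G S H T = {f \<in> hom G H. map f S = T}"

text \<open>The homomorphism from the free group that sends the \<open>i\<close>-th free generator to \<open>S ! i\<close>.\<close>

definition letter_eval :: "'a monoid \<Rightarrow> 'a list \<Rightarrow> letter \<Rightarrow> 'a" where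
  "letter_eval G S x = (if snd x then S ! fst x else inv\<^bsub>G\<^esub> (S ! fst x))"

definition marking_map :: "'a monoid \<Rightarrow> 'a list \<Rightarrow> letter list \<Rightarrow> 'a" where
  "marking_map G S w = foldr (\<lambda>x g. letter_eval G S x \<otimes>\<^bsub>G\<^esub> g) w \<one>\<^bsub>G\<^esub>"

lemma marking_map_simps [simp]:
  "marking_map G S [] = \<one>\<^bsub>G\<^esub>"
  "marking_map G S (x # w) = letter_eval G S x \<otimes>\<^bsub>G\<^esub> marking_map G S w"
  by (simp_all add: marking_map_def)

lemma marking_map_hom:
  assumes "group G" "set S \<subseteq> carrier G"
  shows "marking_map G S \<in> hom (free_group (length S)) G"
proof -
  interpret group G by fact
  let ?ok = "\<lambda>w. fst ` set w \<subseteq> {..<length S}"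
  have gen: "S ! i \<in> carrier G" if "i < length S" for i
    using that assms(2) nth_mem by blast
  have letter: "letter_eval G S x \<in> carrier G" if "fst x < length S" for x
    using gen[OF that] by (simp add: letter_eval_def)
  have closed: "marking_map G S w \<in> carrier G" if "?ok w" for w
    using that by (induction w) (auto simp: letter)
  have inv: "letter_eval G S x \<otimes>\<^bsub>G\<^esub> letter_eval G S (inv_letter x) = \<one>\<^bsub>G\<^esub>"
    if "fst x < length S" for x
    using gen[OF that] by (simp add: letter_eval_def inv_letter_def)
  have cancel: "marking_map G S (cancel_Cons x w) = letter_eval G S x \<otimes>\<^bsub>G\<^esub> marking_map G S w"
    if x: "fst x < length S" and w: "?ok w" for x w
  proof (cases w)
    case (Cons y v)
    then show ?thesis
      using x w by (auto simp: letter closed inv m_assoc[symmetric])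
  qed simp
  have mult: "marking_map G S (foldr cancel_Cons u v) = marking_map G S u \<otimes>\<^bsub>G\<^esub> marking_map G S v"
    if "?ok u" "?ok v" for u v
    using that(1)
  proof (induction u)
    case Nil
    then show ?case using that(2) by (simp add: closed)
  next
    case (Cons x u)
    then have "?ok (foldr cancel_Cons u v)"
      using fst_set_foldr[of u v] that(2) by (simp only: list.set image_insert) blast
    with Cons show ?case
      using that(2) by (simp add: cancel closed letter m_assoc)
  qed
  show ?thesis
    by (rule homI) (auto simp: free_group_def closed mult)
qed

lemma marking_map_generator:
  assumes "group G" "set S \<subseteq> carrier G" "i < length S"
  shows "marking_map G S [(i, True)] = S ! i"
proof -
  interpret group G by fact
  have "S ! i \<in> carrier G"
    using assms(2,3) nth_mem by blast
  then show ?thesis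
    by (simp add: letter_eval_def)
qed

definition chabauty_converges ::
    "nat \<Rightarrow> (nat \<Rightarrow> 'a monoid) \<Rightarrow> (nat \<Rightarrow> 'a list) \<Rightarrow> 'a monoid \<Rightarrow> 'a list \<Rightarrow> bool" where
  "chabauty_converges k G S H T \<longleftrightarrow>
    (\<forall>r. \<forall>\<^sub>F n in sequentially.
      kernel (free_group k) (G n) (marking_map (G n) (S n)) \<inter> free_ball k r =
      kernel (free_group k) H (marking_map H T) \<inter> free_ball k r)"

subsection \<open>Amenability of discrete groups\<close>

text \<open>A left-invariant finitely additive probability measure on all subsets of the group; the
  values of \<open>\<mu>\<close> outside the powerset of the carrier are irrelevant.\<close>

definition amenable :: "'a monoid \<Rightarrow> bool" where
  "amenable G \<longleftrightarrow> (\<exists>\<mu> :: 'a set \<Rightarrow> real.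
    (\<forall>A \<subseteq> carrier G. 0 \<le> \<mu> A) \<and> \<mu> (carrier G) = 1 \<and>
    (\<forall>A \<subseteq> carrier G. \<forall>B \<subseteq> carrier G. A \<inter> B = {} \<longrightarrow> \<mu> (A \<union> B) = \<mu> A + \<mu> B) \<and>
    (\<forall>g \<in> carrier G. \<forall>A \<subseteq> carrier G. \<mu> (g <#\<^bsub>G\<^esub> A) = \<mu> A))"

subsection \<open>The Tychonoff topology on the subsets of the positive integers\<close>

definition indicator_fun :: "nat set \<Rightarrow> nat \<Rightarrow> bool" where
  "indicator_fun J = (\<lambda>m \<in> {1..}. m \<in> J)"

definition tychonoff_converges :: "(nat \<Rightarrow> nat set) \<Rightarrow> nat set \<Rightarrow> bool" where
  "tychonoff_converges Js J \<longleftrightarrow>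
    limitin (product_topology (\<lambda>_. discrete_topology UNIV) {1..})
      (\<lambda>n. indicator_fun (Js n)) (indicator_fun J) sequentially"

lemma limitin_discrete_topology_UNIV:
  "limitin (discrete_topology UNIV) f l F \<longleftrightarrow> (\<forall>\<^sub>F x in F. f x = l)"
proof
  assume "limitin (discrete_topology UNIV) f l F"
  then show "\<forall>\<^sub>F x in F. f x = l"
    unfolding limitin_def by (auto dest: spec[of _ "{l}"])
next
  assume "\<forall>\<^sub>F x in F. f x = l"
  then show "limitin (discrete_topology UNIV) f l F"
    by (auto simp: limitin_def elim: eventually_mono)
qed

lemma tychonoff_converges_iff:
  "tychonoff_converges Js J \<longleftrightarrow>
    (\<forall>m. \<forall>\<^sub>F n in sequentially. Js n \<inter> {1..m} = J \<inter> {1..m})" (is "_ \<longleftrightarrow> ?R")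
proof -
  have "tychonoff_converges Js J \<longleftrightarrow>
      (\<forall>i\<in>{1..}. \<forall>\<^sub>F n in sequentially. (i \<in> Js n) = (i \<in> J))"
    unfolding tychonoff_converges_def limitin_componentwise
    by (simp add: indicator_fun_def limitin_discrete_topology_UNIV)
  also have "\<dots> \<longleftrightarrow> (\<forall>m. \<forall>i\<in>{1..m}. \<forall>\<^sub>F n in sequentially. (i \<in> Js n) = (i \<in> J))"
    by (meson atLeastAtMost_iff atLeast_iff order_refl)
  also have "\<dots> \<longleftrightarrow> (\<forall>m. \<forall>\<^sub>F n in sequentially. \<forall>i\<in>{1..m}. (i \<in> Js n) = (i \<in> J))"
    by (simp add: eventually_ball_finite_distrib)
  also have "\<dots> \<longleftrightarrow> ?R"
  proof -
    have "(\<forall>i\<in>{1..m}. (i \<in> Js n) = (i \<in> J)) \<longleftrightarrow> Js n \<inter> {1..m} = J \<inter> {1..m}" for n m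
      by blast
    then show ?thesis by simp
  qed
  finally show ?thesis .
qed

end

theory Submission
  imports Defs
begin

text \<open>Let \<open>t\<close> shift the line and let \<open>f\<close> act on the line times the plane, in the \<open>j\<close>-th copy, by the shear
  \<open>(a + 3 b, b)\<close> at position \<open>0\<close> and by the shear \<open>(a, b + 3 a)\<close> at position \<open>j\<close>; in copy \<open>0\<close> only
  the first shear is present. The group of \<open>J\<close> is the group generated by \<open>t\<close>, \<open>f\<close> and their inverses
  in its diagonal action on the copies in \<open>J\<close> and copy \<open>0\<close>.
  A word that is short compared with \<open>j\<close> cannot see both positions \<open>0\<close> and \<open>j\<close>, and the two shears are
  conjugate by the swap of coordinates, so copy \<open>j\<close> imposes no more relations than copy \<open>0\<close> on such
  words; this gives continuity. The commutator of \<open>f\<close> with its conjugate by the \<open>n\<close>-th power of \<open>t\<close> acts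
  trivially on all copies except the \<open>n\<close>-th, where it acts at position \<open>n\<close> as a commutator of the two
  shears. If \<open>n\<close> is in \<open>J'\<close> but not in \<open>J\<close>, then conjugates of it lie in the kernel and play ping-pong
  on the plane, which rules out an invariant mean.\<close>

section \<open>Quotients of free groups as marked groups\<close>

lemma marking_map_in_generate:
  assumes "fst ` set w \<subseteq> {..<length S}"
  shows "marking_map G S w \<in> generate G (set S)"
  using assms
proof (induction w)
  case (Cons x w)
  then have "letter_eval G S x \<in> generate G (set S)"
    by (auto simp: letter_eval_def intro: generate.incl generate.inv)
  with Cons show ?case
    by (auto intro: generate.eng)
qed (auto intro: generate.one)

lemma marking_map_image:
  assumes G: "group G" and S: "set S \<subseteq> carrier G" and gen: "generate G (set S) = carrier G"
  shows "marking_map G S ` carrier (free_group (length S)) = carrier G" (is "?I = _")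
proof
  interpret group_hom "free_group (length S)" G "marking_map G S"
    by (simp add: group_hom_def group_hom_axioms_def group_free_group G marking_map_hom S)
  show "?I \<subseteq> carrier G"
    by auto
  have "set S \<subseteq> ?I"
  proof
    fix s assume "s \<in> set S"
    then obtain i where i: "i < length S" "s = S ! i"
      by (metis in_set_conv_nth)
    then have "[(i, True)] \<in> carrier (free_group (length S))"
      by (simp add: free_group_def)
    with i marking_map_generator[OF G S i(1)] show "s \<in> ?I"
      by (metis image_eqI)
  qed
  then show "carrier G \<subseteq> ?I"
    using H.generate_subgroup_incl[OF _ img_is_subgroup] gen by blast
qed

text \<open>The free generators determine \<open>p\<close>; inverse letters follow because
  \<open>(i, False)\<close> is the inverse of \<open>(i, True)\<close>.\<close>

lemma marking_map_eq_hom: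
  assumes G: "group G" and p: "p \<in> hom (free_group k) G"
    and S: "S = map (\<lambda>i. p [(i, True)]) [0..<k]" and w: "w \<in> carrier (free_group k)"
  shows "marking_map G S w = p w"
proof -
  interpret group_hom "free_group k" G p
    by (simp add: group_hom_def group_hom_axioms_def group_free_group G p)
  have carr: "[(i, b)] \<in> carrier (free_group k)" if "i < k" for i b
    using that by (simp add: free_group_def)
  have "p [(i, False)] = inv\<^bsub>G\<^esub> (p [(i, True)])" if "i < k" for i
  proof -
    have "[(i, False)] \<otimes>\<^bsub>free_group k\<^esub> [(i, True)] = \<one>\<^bsub>free_group k\<^esub>"
      by (simp add: free_group_def inv_letter_def)
    then have "[(i, False)] = inv\<^bsub>free_group k\<^esub> [(i, True)]"
      using G.inv_equality[OF _ carr[OF that] carr[OF that]] by simp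
    then show ?thesis
      using hom_inv[OF carr[OF that]] by simp
  qed
  then have letter: "letter_eval G S x = p [x]" if "fst x < k" for x
    using that by (cases x) (auto simp: letter_eval_def S)
  from w show ?thesis
  proof (induction w)
    case Nil
    show ?case using hom_one by (simp add: free_group_def)
  next
    case (Cons x w)
    from Cons.prems have w: "w \<in> carrier (free_group k)" and x: "fst x < k"
      by (auto simp: free_group_def dest: reduced_ConsD)
    from Cons.prems have "[x] \<otimes>\<^bsub>free_group k\<^esub> w = x # w"
      by (simp add: free_group_def cancel_Cons_reduced)
    then have "p (x # w) = p [x] \<otimes>\<^bsub>G\<^esub> p w"
      using hom_mult[OF _ w, of "[x]"] carr[of "fst x" "snd x"] x by simp
    then show ?case
      using Cons.IH[OF w] letter[OF x] by simp
  qed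
qed

text \<open>The coset group is countable, so an injection into \<open>nat\<close> transports it and
  all groups of the family share one type.\<close>

lemma nat_marked_quotient_exists:
  assumes "N \<lhd> free_group k"
  shows "\<exists>(G :: nat monoid) S. group G \<and> length S = k \<and> set S \<subseteq> carrier G \<and>
    generate G (set S) = carrier G \<and> kernel (free_group k) G (marking_map G S) = N"
proof -
  interpret N: normal N "free_group k" by fact
  let ?F = "free_group k" and ?Q = "free_group k Mod N"
  interpret Q: group ?Q by (rule N.factorgroup_is_group)
  have carrQ: "carrier ?Q = (\<lambda>w. N #>\<^bsub>?F\<^esub> w) ` carrier ?F"
    by (auto simp: FactGroup_def RCOSETS_def)
  define h where "h = to_nat_on (carrier ?Q)"
  have inj: "inj_on h (carrier ?Q)"
    unfolding h_def carrQ by (intro inj_on_to_nat_on countable_image countableI_type)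
  let ?d = "inv_into (carrier ?Q) h"
  \<comment> \<open>Only the transported multiplication matters: \<open>G\<close> below restricts
    the carrier to the image of \<open>h\<close> and replaces the arbitrary unit
    \<open>0\<close>.\<close>
  define H :: "nat monoid" where
    "H = \<lparr>carrier = UNIV, mult = \<lambda>a b. h (?d a \<otimes>\<^bsub>?Q\<^esub> ?d b), one = 0\<rparr>"
  have hH: "h \<in> hom ?Q H"
    by (rule homI) (auto simp: H_def inj simp del: mult_FactGroup)
  define G where "G = H\<lparr>carrier := h ` carrier ?Q, one := h \<one>\<^bsub>?Q\<^esub>\<rparr>"
  have G: "group G"
    unfolding G_def by (rule Q.hom_imp_img_group[OF hH])
  have hG: "h \<in> hom ?Q G"
    using hH by (auto simp: hom_def G_def)
  define p where "p = h \<circ> (\<lambda>w. N #>\<^bsub>?F\<^esub> w)"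
  have p: "p \<in> hom ?F G"
    unfolding p_def by (rule hom_compose[OF N.r_coset_hom_Mod hG])
  have onto: "p ` carrier ?F = carrier G"
    by (simp add: p_def G_def carrQ image_image)
  have ker: "p w = \<one>\<^bsub>G\<^esub> \<longleftrightarrow> w \<in> N" if w: "w \<in> carrier ?F" for w
  proof -
    have "p w = \<one>\<^bsub>G\<^esub> \<longleftrightarrow> h (N #>\<^bsub>?F\<^esub> w) = h \<one>\<^bsub>?Q\<^esub>"
      by (simp add: p_def G_def)
    also have "\<dots> \<longleftrightarrow> N #>\<^bsub>?F\<^esub> w = N"
      using inj_on_eq_iff[OF inj] w carrQ Q.one_closed by (metis imageI one_FactGroup)
    also have "\<dots> \<longleftrightarrow> w \<in> N"
      using w N.coset_join1 N.coset_join2 N.is_subgroup by blast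
    finally show ?thesis .
  qed
  define S where "S = map (\<lambda>i. p [(i, True)]) [0..<k]"
  note mm = marking_map_eq_hom[OF G p S_def]
  have S: "length S = k" "set S \<subseteq> carrier G"
    using onto by (auto simp: S_def free_group_def)
  have "generate G (set S) = carrier G"
  proof
    show "generate G (set S) \<subseteq> carrier G"
      using group.generate_incl[OF G S(2)] .
    show "carrier G \<subseteq> generate G (set S)"
    proof
      fix g assume "g \<in> carrier G"
      then obtain w where w: "w \<in> carrier ?F" "g = p w"
        using onto by blast
      then show "g \<in> generate G (set S)"
        using marking_map_in_generate[of w S G] mm[OF w(1)] S(1) by (simp add: free_group_def)
    qed
  qed
  moreover have "kernel ?F G (marking_map G S) = N"
    using ker mm N.subset by (auto simp: kernel_def)
  ultimately show ?thesis
    using G S by blast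
qed

text \<open>Two preimages of one element under \<open>p\<close> differ by an element of the kernel
  of \<open>p\<close>, on which \<open>q\<close> is trivial too, so applying \<open>q\<close> to a
  chosen preimage is well defined.\<close>

lemma hom_factor_through_surjection:
  assumes p: "group_hom F A p" "p ` carrier F = carrier A"
    and q: "group_hom F B q" "q ` carrier F = carrier B"
    and le: "kernel F A p \<subseteq> kernel F B q"
  obtains f where "f \<in> hom A B" "\<And>w. w \<in> carrier F \<Longrightarrow> f (p w) = q w"
    "f ` carrier A = carrier B" "kernel A B f = p ` kernel F B q"
proof -
  interpret p: group_hom F A p by (rule p)
  interpret q: group_hom F B q by (rule q)
  define f where "f = q \<circ> inv_into (carrier F) p"
  have f: "f (p w) = q w" if w: "w \<in> carrier F" for w
  proof -
    define v where "v = inv_into (carrier F) p (p w)"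
    have v: "v \<in> carrier F" "p v = p w"
      using w by (auto simp: v_def inv_into_into f_inv_into_f)
    then have "v \<otimes>\<^bsub>F\<^esub> inv\<^bsub>F\<^esub> w \<in> kernel F A p"
      using w by (simp add: kernel_def)
    then have "v \<otimes>\<^bsub>F\<^esub> inv\<^bsub>F\<^esub> w \<in> kernel F B q"
      using le by blast
    then have "q v \<otimes>\<^bsub>B\<^esub> inv\<^bsub>B\<^esub> (q w) = \<one>\<^bsub>B\<^esub>"
      using v(1) w by (simp add: kernel_def)
    then have "q v = q w"
      using q.H.inv_equality[of "q v" "inv\<^bsub>B\<^esub> (q w)"] v(1) w by simp
    then show ?thesis
      by (simp add: f_def v_def)
  qed
  have "f \<in> hom A B"
  proof (rule homI)
    show "f x \<in> carrier B" if x: "x \<in> carrier A" for x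
    proof -
      obtain u where "u \<in> carrier F" "x = p u"
        using x unfolding p(2)[symmetric] by blast
      then show ?thesis
        using f[of u] by simp
    qed
    show "f (x \<otimes>\<^bsub>A\<^esub> y) = f x \<otimes>\<^bsub>B\<^esub> f y" if xy: "x \<in> carrier A" "y \<in> carrier A" for x y
    proof -
      obtain u v where "u \<in> carrier F" "v \<in> carrier F" "x = p u" "y = p v"
        using xy unfolding p(2)[symmetric] by blast
      then show ?thesis
        using f[of "u \<otimes>\<^bsub>F\<^esub> v"] f[of u] f[of v] by simp
    qed
  qed
  moreover have "f ` carrier A = carrier B"
    unfolding p(2)[symmetric] q(2)[symmetric] image_image using f by (rule image_cong[OF refl])
  moreover have "kernel A B f = p ` kernel F B q"
    unfolding kernel_def p(2)[symmetric] using f by auto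
  ultimately show ?thesis
    using that[OF _ f] by blast
qed

section \<open>A criterion for nonamenability\<close>

text \<open>P, gP and ggP are pairwise disjoint, the last two being the g-translates of P and gP, so
  an invariant mean gives P at most 1/3. Since hQ lies in P, the same bound holds for Q, and the two
  cannot cover the group.\<close>

lemma not_amenable_if_paradoxical:
  assumes G: "group G" and PQ: "P \<subseteq> carrier G" "Q \<subseteq> carrier G" "carrier G \<subseteq> P \<union> Q"
    and g: "g \<in> carrier G" "(g <#\<^bsub>G\<^esub> P) \<inter> P = {}" "((g \<otimes>\<^bsub>G\<^esub> g) <#\<^bsub>G\<^esub> P) \<inter> P = {}"
    and h: "h \<in> carrier G" "h <#\<^bsub>G\<^esub> Q \<subseteq> P"
  shows "\<not> amenable G"
proof
  interpret group G by fact
  assume "amenable G"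
  then obtain \<mu> :: "'a set \<Rightarrow> real" where \<mu>: "\<forall>A\<subseteq>carrier G. 0 \<le> \<mu> A" "\<mu> (carrier G) = 1"
    "\<forall>A\<subseteq>carrier G. \<forall>B\<subseteq>carrier G. A \<inter> B = {} \<longrightarrow> \<mu> (A \<union> B) = \<mu> A + \<mu> B"
    "\<forall>g\<in>carrier G. \<forall>A\<subseteq>carrier G. \<mu> (g <#\<^bsub>G\<^esub> A) = \<mu> A"
    unfolding amenable_def by (elim exE conjE)
  have pos: "0 \<le> \<mu> A" if "A \<subseteq> carrier G" for A
    using \<mu>(1) that by simp
  have add: "\<mu> (A \<union> B) = \<mu> A + \<mu> B" if "A \<subseteq> carrier G" "B \<subseteq> carrier G" "A \<inter> B = {}" for A B
    using \<mu>(3) that by simp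
  have inv: "\<mu> (g <#\<^bsub>G\<^esub> A) = \<mu> A" if "g \<in> carrier G" "A \<subseteq> carrier G" for g A
    using \<mu>(4) that by simp
  have mono: "\<mu> A \<le> \<mu> B" if "A \<subseteq> B" "B \<subseteq> carrier G" for A B
  proof -
    have "A \<union> (B - A) = B" "A \<subseteq> carrier G" "B - A \<subseteq> carrier G"
      using that by auto
    then show ?thesis
      using add[of A "B - A"] pos[of "B - A"] by simp
  qed
  let ?P1 = "g <#\<^bsub>G\<^esub> P" and ?P2 = "(g \<otimes>\<^bsub>G\<^esub> g) <#\<^bsub>G\<^esub> P"
  have sub: "?P1 \<subseteq> carrier G" "?P2 \<subseteq> carrier G"
    using l_coset_subset_G g(1) PQ(1) by auto
  have "?P1 \<inter> ?P2 = ?P1 \<inter> (g <#\<^bsub>G\<^esub> ?P1)"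
    using lcos_m_assoc[OF PQ(1) g(1) g(1)] by simp
  also have "\<dots> = g <#\<^bsub>G\<^esub> (P \<inter> ?P1)"
    using inj_on_image_Int[OF inj_on_cmult[OF g(1)] PQ(1) sub(1)]
    by (simp add: l_coset_def UNION_singleton_eq_range)
  finally have disj: "?P1 \<inter> ?P2 = {}"
    using g(2) by (simp add: l_coset_def Int_commute)
  have "\<mu> (P \<union> (?P1 \<union> ?P2)) = \<mu> P + (\<mu> P + \<mu> P)"
    using add[of P "?P1 \<union> ?P2"] add[of ?P1 ?P2] inv PQ(1) g sub disj
    by (simp add: Int_Un_distrib Int_commute)
  then have P: "3 * \<mu> P \<le> 1"
    using mono[of "P \<union> (?P1 \<union> ?P2)" "carrier G"] PQ(1) sub \<mu>(2) by simp
  have Q: "\<mu> Q \<le> \<mu> P"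
    using mono[OF h(2) PQ(1)] inv[OF h(1) PQ(2)] by simp
  have "carrier G = P \<union> (Q - P)"
    using PQ by blast
  then have "1 = \<mu> P + \<mu> (Q - P)"
    using add[of P "Q - P"] PQ \<mu>(2) by auto
  also have "\<dots> \<le> \<mu> P + \<mu> Q"
    using mono[of "Q - P" Q] PQ(2) by simp
  finally show False
    using P Q by simp
qed

section \<open>Lamplighter-like actions of the free group\<close>

text \<open>In copy \<open>j\<close> a state \<open>(z, a, b)\<close> is a vector \<open>(a, b)\<close> at position \<open>z\<close> of the line. The
  positive letters \<open>0\<close>, \<open>1\<close>, \<open>2\<close>, \<open>3\<close> act as \<open>t\<close>, the inverse of \<open>t\<close>, \<open>f\<close>, the inverse of \<open>f\<close>.
  Copy \<open>0\<close> has only the lamp of the first shear, since the test \<open>z = 0\<close> comes first.\<close>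

fun letter_act :: "int \<Rightarrow> letter \<Rightarrow> int \<times> int \<times> int \<Rightarrow> int \<times> int \<times> int" where
  "letter_act j x (z, a, b) =
    (let e = (if snd x = even (fst x) then 1 else -1) in
     if fst x < 2 then (z + e, a, b)
     else if z = 0 then (z, a + 3 * e * b, b)
     else if z = j then (z, a, b + 3 * e * a)
     else (z, a, b))"

definition word_act :: "int \<Rightarrow> letter list \<Rightarrow> int \<times> int \<times> int \<Rightarrow> int \<times> int \<times> int" where
  "word_act j = foldr (letter_act j)"

lemma word_act_simps [simp]:
  "word_act j [] s = s"
  "word_act j (x # w) s = letter_act j x (word_act j w s)"
  "word_act j (u @ v) s = word_act j u (word_act j v s)"
  by (simp_all add: word_act_def)

lemma letter_act_inv [simp]: "letter_act j x (letter_act j (inv_letter x) s) = s"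
  by (cases s; cases x) (auto simp: inv_letter_def Let_def algebra_simps)

lemma word_act_cancel_Cons [simp]:
  "word_act j (cancel_Cons x w) s = letter_act j x (word_act j w s)"
  by (cases w) auto

lemma word_act_foldr [simp]:
  "word_act j (foldr cancel_Cons u v) s = word_act j u (word_act j v s)"
  by (induction u) auto

lemma word_act_mult [simp]:
  "word_act j (u \<otimes>\<^bsub>free_group k\<^esub> v) s = word_act j u (word_act j v s)"
  by (simp add: free_group_def)

lemma word_act_inv:
  assumes "w \<in> carrier (free_group k)"
  shows "word_act j (inv\<^bsub>free_group k\<^esub> w) (word_act j w s) = s"
    "word_act j w (word_act j (inv\<^bsub>free_group k\<^esub> w) s) = s"
proof -
  interpret group "free_group k" by (rule group_free_group)
  have one: "word_act j \<one>\<^bsub>free_group k\<^esub> s = s"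
    by (simp add: free_group_def)
  show "word_act j (inv\<^bsub>free_group k\<^esub> w) (word_act j w s) = s"
    using one l_inv[OF assms] word_act_mult by metis
  show "word_act j w (word_act j (inv\<^bsub>free_group k\<^esub> w) s) = s"
    using one r_inv[OF assms] word_act_mult by metis
qed

text \<open>Copy \<open>0\<close> belongs to every group: it controls all far copies on short words
  and keeps the four generators distinct even for empty \<open>J\<close>. Enlarging \<open>J\<close>
  shrinks this set, which gives the direction of the surjections.\<close>

definition act_kernel :: "nat set \<Rightarrow> letter list set" where
  "act_kernel J =
    {w \<in> carrier (free_group 4). \<forall>j \<in> insert 0 J. \<forall>s. word_act (int j) w s = s}"

lemma normal_act_kernel: "act_kernel J \<lhd> free_group 4"
proof -
  interpret group "free_group 4" by (rule group_free_group)
  show ?thesis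
  proof (rule normal_invI)
    show "subgroup (act_kernel J) (free_group 4)"
    proof (rule subgroupI)
      have "\<one>\<^bsub>free_group 4\<^esub> \<in> act_kernel J"
        using one_closed by (auto simp: act_kernel_def) (simp_all add: free_group_def)
      then show "act_kernel J \<noteq> {}" by blast
      show "inv\<^bsub>free_group 4\<^esub> u \<in> act_kernel J" if "u \<in> act_kernel J" for u
      proof -
        have "u \<in> carrier (free_group 4)"
          using that by (simp add: act_kernel_def)
        with that word_act_inv(1)[OF this] show ?thesis
          unfolding act_kernel_def by simp metis
      qed
    qed (auto simp: act_kernel_def)
    show "x \<otimes>\<^bsub>free_group 4\<^esub> h \<otimes>\<^bsub>free_group 4\<^esub> inv\<^bsub>free_group 4\<^esub> x \<in> act_kernel J"
      if "x \<in> carrier (free_group 4)" "h \<in> act_kernel J" for x h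
      using that word_act_inv(2)[of x 4] by (auto simp: act_kernel_def simp del: split_paired_All)
  qed
qed

lemma act_kernelD:
  assumes "w \<in> act_kernel J"
  shows "w \<in> carrier (free_group 4)" "j \<in> insert 0 J \<Longrightarrow> word_act (int j) w s = s"
  using assms unfolding act_kernel_def by blast+

text \<open>The quotient of u by v lies in the kernel, so the action on each copy in
  \<open>insert 0 J\<close> descends to \<open>G\<close>.\<close>

lemma word_act_eq_if_hom_eq:
  assumes p: "group_hom (free_group 4) G p" and ker: "kernel (free_group 4) G p = act_kernel J"
    and uv: "u \<in> carrier (free_group 4)" "v \<in> carrier (free_group 4)" "p u = p v"
    and j: "j \<in> insert 0 J"
  shows "word_act (int j) u s = word_act (int j) v s"
proof -
  interpret group_hom "free_group 4" G p by (rule p)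
  have "u \<otimes>\<^bsub>free_group 4\<^esub> inv\<^bsub>free_group 4\<^esub> v \<in> kernel (free_group 4) G p"
    using uv by (simp add: kernel_def)
  from act_kernelD(2)[OF this[unfolded ker] j, of "word_act (int j) v s"] show ?thesis
    using word_act_inv(1)[OF uv(2)] by simp
qed

subsection \<open>Short words see at most one lamp\<close>

text \<open>Positions change only under the letters for t and its inverse, which act alike in all
  copies. Hence a word trivial on copy \<open>0\<close> preserves positions in every copy.\<close>

lemma fst_word_act: "fst (word_act j w s) = fst (word_act 0 w s)"
proof (induction w)
  case (Cons x w)
  then show ?case
    by (cases "word_act j w s"; cases "word_act 0 w s") (auto simp: Let_def)
qed simp

lemma fst_word_act_le: "\<bar>fst (word_act j w s) - fst s\<bar> \<le> int (length w)"
proof (induction w)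
  case (Cons x w)
  then show ?case
    by (cases "word_act j w s"; cases s) (auto simp: Let_def)
qed simp

text \<open>Each suffix of \<open>w\<close> keeps the state within distance \<open>length w\<close>
  of its start, so position \<open>j\<close> is never reached.\<close>

lemma word_act_away_from_second_lamp:
  assumes "int (length w) < \<bar>fst s - j\<bar>"
  shows "word_act j w s = word_act 0 w s"
  using assms
proof (induction w)
  case (Cons x w)
  then have "fst (word_act 0 w s) \<noteq> j"
    using fst_word_act_le[of 0 w s] by auto
  with Cons show ?case
    by (cases "word_act 0 w s") (auto simp: Let_def)
qed simp

text \<open>Intertwines the lamp of copy \<open>0\<close> with the second lamp of copy
  \<open>j\<close>: position \<open>0\<close> becomes \<open>j\<close>, and swapping coordinates
  exchanges the shears.\<close>

fun swap_lamps :: "int \<Rightarrow> int \<times> int \<times> int \<Rightarrow> int \<times> int \<times> int" where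
  "swap_lamps j (z, a, b) = (z + j, b, a)"

lemma word_act_away_from_first_lamp:
  assumes "int (length w) < \<bar>fst s + j\<bar>" "j \<noteq> 0"
  shows "word_act j w (swap_lamps j s) = swap_lamps j (word_act 0 w s)"
  using assms
proof (induction w)
  case (Cons x w)
  then have "fst (word_act 0 w s) + j \<noteq> 0"
    using fst_word_act_le[of 0 w s] by auto
  with Cons show ?case
    by (cases "word_act 0 w s") (auto simp: Let_def)
qed simp

text \<open>From any start at least one of the positions \<open>0\<close> and \<open>j\<close> is
  out of reach; the action is then that of copy \<open>0\<close>, directly or through
  \<open>swap_lamps\<close>.\<close>

lemma word_act_trivial_far:
  assumes w: "\<And>s. word_act 0 w s = s" and j: "2 * int (length w) < j"
  shows "word_act j w s = s"
proof (cases "int (length w) < \<bar>fst s - j\<bar>")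
  case True
  then show ?thesis
    using w word_act_away_from_second_lamp by simp
next
  case False
  obtain s' where s': "s = swap_lamps j s'"
    by (cases s) (metis diff_add_cancel swap_lamps.simps)
  with False j show ?thesis
    using w word_act_away_from_first_lamp[of w s' j] by (cases s') auto
qed

text \<open>Copies up to \<open>2 * r\<close> are common to both index sets; on words of length at
  most \<open>r\<close>, triviality in any later copy follows from copy \<open>0\<close>.\<close>

lemma act_kernel_inter_ball:
  assumes "J \<inter> {1..2 * r} = J' \<inter> {1..2 * r}"
  shows "act_kernel J \<inter> free_ball 4 r \<subseteq> act_kernel J'"
proof
  fix w assume w: "w \<in> act_kernel J \<inter> free_ball 4 r"
  then have len: "length w \<le> r" and triv: "\<And>j s. j \<in> insert 0 J \<Longrightarrow> word_act (int j) w s = s"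
    by (auto simp: free_ball_def act_kernel_def)
  have "word_act (int j) w s = s" if "j \<in> insert 0 J'" for j s
  proof (cases "j \<le> 2 * r")
    case True
    then have "j \<in> insert 0 J"
    proof (cases "j = 0")
      case False
      then have "j \<in> J' \<inter> {1..2 * r}"
        using that True by simp
      then show ?thesis
        unfolding assms[symmetric] by simp
    qed simp
    then show ?thesis by (rule triv)
  next
    case False
    then show ?thesis
      using len triv[of 0] word_act_trivial_far[of w "int j" s] by simp
  qed
  then show "w \<in> act_kernel J'"
    using w by (auto simp: act_kernel_def)
qed

subsection \<open>Ping-pong inside one copy\<close>

lemma word_act_nonzero: "snd s \<noteq> (0, 0) \<Longrightarrow> snd (word_act j w s) \<noteq> (0, 0)"
proof (induction w)
  case (Cons x w)
  then show ?case
    by (cases "word_act j w s") (auto simp: Let_def)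
qed simp

section \<open>Words for shifted lamps and their commutators\<close>

definition shift_word :: "int \<Rightarrow> letter list" where
  "shift_word n = replicate (nat \<bar>n\<bar>) (0, 0 \<le> n)"

definition lamp_word :: "int \<Rightarrow> letter list" where
  "lamp_word k = replicate (nat \<bar>k\<bar>) (2, 0 \<le> k)"

text \<open>This is t^n f^k t^-n. In copy \<open>n\<close>, for nonzero \<open>n\<close>, position
  \<open>n\<close> carries the second shear of f and the first shear of this conjugate.\<close>

definition shifted_lamp_word :: "int \<Rightarrow> int \<Rightarrow> letter list" where
  "shifted_lamp_word n k = shift_word n @ lamp_word k @ shift_word (- n)"

definition lamp_commutator :: "int \<Rightarrow> letter list" where
  "lamp_commutator n =
    lamp_word 1 @ shifted_lamp_word n 1 @ lamp_word (-1) @ shifted_lamp_word n (-1)"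

lemmas lamp_words_def = shift_word_def lamp_word_def shifted_lamp_word_def lamp_commutator_def

lemma word_act_shift: "word_act j (shift_word n) (z, a, b) = (z + n, a, b)"
proof -
  have "word_act j (replicate m (0, c)) (z, a, b) = (z + (if c then int m else - int m), a, b)"
    for m c
    by (induction m) auto
  then show ?thesis
    by (simp add: shift_word_def)
qed

lemma word_act_lamp:
  "word_act j (lamp_word k) (z, a, b) =
    (if z = 0 then (z, a + 3 * k * b, b) else if z = j then (z, a, b + 3 * k * a) else (z, a, b))"
proof -
  have "word_act j (replicate m (2, c)) (z, a, b) =
      (let k = (if c then int m else - int m) in
       if z = 0 then (z, a + 3 * k * b, b) else if z = j then (z, a, b + 3 * k * a) else (z, a, b))"
    for m c
    by (induction m) (auto simp: Let_def algebra_simps)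
  then show ?thesis
    by (simp add: lamp_word_def Let_def)
qed

lemma word_act_shifted_lamp:
  "word_act j (shifted_lamp_word n k) (z, a, b) =
    (if z = n then (z, a + 3 * k * b, b)
     else if z = n + j then (z, a, b + 3 * k * a) else (z, a, b))"
  by (auto simp: shifted_lamp_word_def word_act_shift word_act_lamp)

lemma word_act_lamp_add:
  "word_act j (lamp_word k) (word_act j (lamp_word l) s) = word_act j (lamp_word (k + l)) s"
  by (cases s) (simp add: word_act_lamp distrib_right distrib_left)

lemma word_act_shifted_lamp_add:
  "word_act j (shifted_lamp_word n k) (word_act j (shifted_lamp_word n l) s) =
    word_act j (shifted_lamp_word n (k + l)) s"
  by (cases s) (simp add: word_act_shifted_lamp distrib_right distrib_left)

text \<open>The two factors move only points at the positions \<open>0\<close>, \<open>j\<close> and \<open>n\<close>, \<open>n + j\<close>,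
  and these sets of positions meet only if \<open>j = n\<close>.\<close>

lemma word_act_lamp_commutator_trivial:
  assumes "0 < n" "0 \<le> j" "j \<noteq> n"
  shows "word_act j (lamp_commutator n) s = s"
proof -
  obtain z a b where s: "s = (z, a, b)"
    by (cases s)
  consider "z = 0" | "z = j" "z \<noteq> 0" | "z \<noteq> 0" "z \<noteq> j"
    by blast
  then show ?thesis
  proof cases
    case 3
    then show ?thesis
      by (cases "z = n"; cases "z = n + j")
        (simp_all add: s lamp_commutator_def word_act_shifted_lamp word_act_lamp)
  qed (use assms in \<open>simp_all add: s lamp_commutator_def word_act_shifted_lamp word_act_lamp\<close>)
qed

text \<open>The commutator begins and ends with different shears. Conjugation makes
  \<open>first_pong\<close> begin and end with the first shear at position \<open>n\<close> of copy
  \<open>n\<close>, hence map \<open>tall n\<close> into \<open>wide n\<close>;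
  \<open>second_pong\<close> does the reverse.\<close>

definition first_pong :: "int \<Rightarrow> letter list" where
  "first_pong n = shifted_lamp_word n 1 @ lamp_commutator n @ shifted_lamp_word n (-1)"

definition second_pong :: "int \<Rightarrow> letter list" where
  "second_pong n = lamp_word 1 @ lamp_commutator n @ lamp_word (-1)"

lemma word_act_pong_trivial:
  assumes "0 < n" "0 \<le> j" "j \<noteq> n"
  shows "word_act j (first_pong n) s = s" "word_act j (second_pong n) s = s"
proof -
  obtain z a b where s: "s = (z, a, b)"
    by (cases s)
  show "word_act j (first_pong n) s = s"
    by (simp add: first_pong_def word_act_lamp_commutator_trivial[OF assms]
        word_act_shifted_lamp_add) (simp add: s word_act_shifted_lamp)
  show "word_act j (second_pong n) s = s"
    by (simp add: second_pong_def word_act_lamp_commutator_trivial[OF assms]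
        word_act_lamp_add) (simp add: s word_act_lamp)
qed

text \<open>The triangle inequality leaves at least twice the absolute value of b. With 2 in place
  of 3, strictness would fail at a = -b, k = 1.\<close>

lemma ping_pong_step:
  fixes a b k :: int
  assumes "\<bar>a\<bar> \<le> \<bar>b\<bar>" "b \<noteq> 0" "k \<noteq> 0"
  shows "\<bar>b\<bar> < \<bar>a + 3 * k * b\<bar>"
proof -
  have "3 * \<bar>b\<bar> \<le> 3 * (\<bar>k\<bar> * \<bar>b\<bar>)"
    using assms(3) mult_right_mono[of 1 "\<bar>k\<bar>" "\<bar>b\<bar>"] by simp
  also have "\<dots> = \<bar>3 * k * b\<bar>"
    by (simp add: abs_mult)
  finally show ?thesis
    using assms(1,2) by linarith
qed

definition tall :: "int \<Rightarrow> (int \<times> int \<times> int) set" where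
  "tall n = {(z, a, b). z = n \<and> \<bar>a\<bar> \<le> \<bar>b\<bar> \<and> b \<noteq> 0}"

definition wide :: "int \<Rightarrow> (int \<times> int \<times> int) set" where
  "wide n = {(z, a, b). z = n \<and> \<bar>b\<bar> < \<bar>a\<bar>}"

lemma tall_inter_wide: "tall n \<inter> wide n = {}"
  by (auto simp: tall_def wide_def)

lemma tall_or_wide:
  assumes "fst s = n" "snd s \<noteq> (0, 0)"
  shows "s \<in> tall n \<or> s \<in> wide n"
  using assms by (cases s) (auto simp: tall_def wide_def)

lemma ping:
  assumes "s \<in> tall n" "k \<noteq> 0"
  shows "word_act n (shifted_lamp_word n k) s \<in> wide n"
proof -
  obtain a b where "s = (n, a, b)" "\<bar>a\<bar> \<le> \<bar>b\<bar>" "b \<noteq> 0"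
    using assms(1) by (auto simp: tall_def)
  then show ?thesis
    using ping_pong_step[of a b k] assms(2) by (simp add: wide_def word_act_shifted_lamp)
qed

lemma pong:
  assumes "s \<in> wide n" "k \<noteq> 0" "n \<noteq> 0"
  shows "word_act n (lamp_word k) s \<in> tall n"
proof -
  obtain a b where s: "s = (n, a, b)" "\<bar>b\<bar> < \<bar>a\<bar>"
    using assms(1) by (auto simp: wide_def)
  then have "\<bar>a\<bar> < \<bar>b + 3 * k * a\<bar>"
    using ping_pong_step[of b a k] assms(2) by linarith
  then have "\<bar>a\<bar> \<le> \<bar>b + 3 * k * a\<bar>" "b + 3 * k * a \<noteq> 0"
    by linarith+
  then show ?thesis
    using s(1) assms(3) by (simp add: tall_def word_act_lamp)
qed

lemma second_pong_wide:
  assumes "s \<in> wide n" "n \<noteq> 0"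
  shows "word_act n (second_pong n) s \<in> tall n"
  using assms by (simp add: second_pong_def lamp_commutator_def word_act_lamp_add ping pong)

text \<open>In the square, the adjacent powers -2 and 1 of the shifted lamp merge to -1, so the
  shears still alternate.\<close>

lemma first_pong_tall:
  assumes "s \<in> tall n" "n \<noteq> 0"
  shows "word_act n (first_pong n) s \<in> wide n"
    "word_act n (first_pong n) (word_act n (first_pong n) s) \<in> wide n"
  using assms
  by (simp_all add: first_pong_def lamp_commutator_def word_act_shifted_lamp_add ping pong)

section \<open>The family of marked groups\<close>

text \<open>The explicit words are concatenations that need not be reduced, as elements of the free
  group must be.\<close>

definition reduce :: "letter list \<Rightarrow> letter list" where
  "reduce w = foldr cancel_Cons w []"

lemma word_act_reduce [simp]: "word_act j (reduce w) s = word_act j w s"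
  by (simp add: reduce_def)

lemma reduce_in_free_group:
  assumes "fst ` set w \<subseteq> {..<k}"
  shows "reduce w \<in> carrier (free_group k)"
  using assms fst_set_foldr[of w "[]"] by (auto simp: reduce_def free_group_def reduced_foldr)

lemma pong_letters:
  "fst ` set (first_pong n) \<subseteq> {..<4}" "fst ` set (second_pong n) \<subseteq> {..<4}"
  by (auto simp: first_pong_def second_pong_def lamp_words_def)

lemma reduce_pong_in_act_kernel:
  assumes "0 < n" "n \<notin> J"
  shows "reduce (first_pong (int n)) \<in> act_kernel J" "reduce (second_pong (int n)) \<in> act_kernel J"
proof -
  have "int j \<noteq> int n" if "j \<in> insert 0 J" for j
    using that assms by auto
  then show "reduce (first_pong (int n)) \<in> act_kernel J"
    "reduce (second_pong (int n)) \<in> act_kernel J"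
    using assms(1) reduce_in_free_group[OF pong_letters(1)] reduce_in_free_group[OF pong_letters(2)]
    by (simp_all add: act_kernel_def word_act_pong_trivial)
qed

text \<open>This subgroup will be the kernel of the surjection. It acts on copy \<open>n\<close>
  because \<open>n\<close> is in \<open>J'\<close>; pulling \<open>tall n\<close> and
  \<open>wide n\<close> back along an orbit map gives the sets for the paradoxical
  criterion.\<close>

lemma not_amenable_image_act_kernel:
  fixes G :: "'a monoid"
  assumes p: "group_hom (free_group 4) G p" and ker: "kernel (free_group 4) G p = act_kernel J'"
    and n: "n \<in> J'" "n \<notin> J" "0 < n"
  shows "\<not> amenable (G\<lparr>carrier := p ` act_kernel J\<rparr>)" (is "\<not> amenable ?K")
proof -
  interpret group_hom "free_group 4" G p by (rule p)
  have N: "subgroup (act_kernel J) (free_group 4)"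
    using normal_act_kernel by (rule normal_imp_subgroup)
  then have K: "group ?K"
    by (intro H.subgroup_imp_group subgroup_img_is_subgroup)
  have carr: "u \<in> carrier (free_group 4)" if "u \<in> act_kernel J" for u
    using that by (simp add: act_kernel_def)
  have eq: "word_act n u s = word_act n v s"
    if "u \<in> act_kernel J" "v \<in> act_kernel J" "p u = p v" for u v s
    using word_act_eq_if_hom_eq[OF p ker] that carr n(1) by simp
  \<comment> \<open>A nonzero vector at position \<open>n\<close>: its orbit keeps both properties,
    so it stays in the union of \<open>tall n\<close> and \<open>wide n\<close>.\<close>
  let ?s = "(int n, 0, 1) :: int \<times> int \<times> int"
  define region where "region A = p ` {w \<in> act_kernel J. word_act n w ?s \<in> A}" for A
  have region_iff: "p w \<in> region A \<longleftrightarrow> word_act n w ?s \<in> A" if w: "w \<in> act_kernel J" for w A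
  proof
    assume "p w \<in> region A"
    then obtain v where v: "v \<in> act_kernel J" "word_act n v ?s \<in> A" "p w = p v"
      unfolding region_def by blast
    then show "word_act n w ?s \<in> A"
      using eq[OF w v(1,3)] by simp
  qed (use w in \<open>simp add: region_def\<close>)
  have moved: "p v <#\<^bsub>?K\<^esub> region A \<subseteq> region B"
    if v: "v \<in> act_kernel J" "\<And>s. s \<in> A \<Longrightarrow> word_act n v s \<in> B" for v A B
  proof
    fix x assume "x \<in> p v <#\<^bsub>?K\<^esub> region A"
    then obtain y where y: "y \<in> region A" "x = p v \<otimes>\<^bsub>G\<^esub> y"
      by (auto simp: l_coset_def)
    then obtain w where w: "w \<in> act_kernel J" "word_act n w ?s \<in> A" "y = p w"
      unfolding region_def by blast
    then have "x = p (v \<otimes>\<^bsub>free_group 4\<^esub> w)"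
      using y(2) v(1) carr by simp
    then show "x \<in> region B"
      using region_iff subgroup.m_closed[OF N v(1) w(1)] v(2)[OF w(2)] by simp
  qed
  have disj: "region (tall n) \<inter> region (wide n) = {}"
  proof -
    have False if x: "x \<in> region (tall n)" "x \<in> region (wide n)" for x
    proof -
      obtain w where "w \<in> act_kernel J" "x = p w"
        using x(1) by (auto simp: region_def)
      then show False
        using x region_iff tall_inter_wide[of n] by blast
    qed
    then show ?thesis by blast
  qed
  define g where "g = reduce (first_pong (int n))"
  define h where "h = reduce (second_pong (int n))"
  have g: "g \<in> act_kernel J" and h: "h \<in> act_kernel J"
    unfolding g_def h_def using reduce_pong_in_act_kernel n by auto
  show ?thesis
  proof (rule not_amenable_if_paradoxical[OF K])
    show "region (tall n) \<subseteq> carrier ?K" "region (wide n) \<subseteq> carrier ?K"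
      by (auto simp: region_def)
    show "carrier ?K \<subseteq> region (tall n) \<union> region (wide n)"
    proof
      fix x assume "x \<in> carrier ?K"
      then obtain w where w: "w \<in> act_kernel J" "x = p w"
        by auto
      have pos: "fst (word_act n w ?s) = n"
        using fst_word_act[of n w] act_kernelD(2)[OF w(1), of 0] by simp
      have "word_act n w ?s \<in> tall n \<union> wide n"
        using tall_or_wide[OF pos word_act_nonzero] by simp
      then show "x \<in> region (tall n) \<union> region (wide n)"
        using w region_iff by auto
    qed
    show "p g \<in> carrier ?K" "p h \<in> carrier ?K"
      using g h by auto
    have "p g <#\<^bsub>?K\<^esub> region (tall n) \<subseteq> region (wide n)"
      using n by (intro moved g) (simp add: g_def first_pong_tall)
    then show "(p g <#\<^bsub>?K\<^esub> region (tall n)) \<inter> region (tall n) = {}"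
      using disj by blast
    have gg: "p g \<otimes>\<^bsub>?K\<^esub> p g = p (g \<otimes>\<^bsub>free_group 4\<^esub> g)"
      using g carr by simp
    have "p (g \<otimes>\<^bsub>free_group 4\<^esub> g) <#\<^bsub>?K\<^esub> region (tall n) \<subseteq> region (wide n)"
      using n subgroup.m_closed[OF N g g] by (intro moved) (simp_all add: g_def first_pong_tall)
    then show "((p g \<otimes>\<^bsub>?K\<^esub> p g) <#\<^bsub>?K\<^esub> region (tall n)) \<inter> region (tall n) = {}"
      unfolding gg using disj by blast
    show "p h <#\<^bsub>?K\<^esub> region (wide n) \<subseteq> region (tall n)"
      using n by (intro moved h) (simp add: h_def second_pong_wide)
  qed
qed

lemma marked_group_act_kernel:
  assumes G: "group G" and S: "length S = 4" "set S \<subseteq> carrier G"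
    and gen: "generate G (set S) = carrier G"
    and ker: "kernel (free_group 4) G (marking_map G S) = act_kernel J"
  shows "marked_group 4 G S"
proof -
  let ?F = "free_group 4" and ?m = "marking_map G S"
  interpret group_hom ?F G ?m
    using marking_map_hom[OF G S(2)] S(1)
    by (simp add: group_hom_def group_hom_axioms_def group_free_group G)
  have carr: "[(i, b)] \<in> carrier ?F" if "i < 4" for i b
    using that by (simp add: free_group_def)
  have gens: "?m [(i, True)] = S ! i" if "i < 4" for i
    using marking_map_generator[OF G S(2)] that S(1) by simp
  have act_eq: "word_act 0 [(i, True)] s = word_act 0 [(i', True)] s"
    if "i < 4" "i' < 4" "S ! i = S ! i'" for i i' s
    using word_act_eq_if_hom_eq[OF group_hom_axioms ker carr carr, of i i' True True 0] that gens
    by simp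
  \<comment> \<open>The four generators send this state to (1, 0, 1), (-1, 0, 1), (0, 3, 1) and (0,
    -3, 1).\<close>
  have inj: "i = i'" if "i < 4" "i' < 4"
      "word_act 0 [(i, True)] (0, 0, 1) = word_act 0 [(i', True)] (0, 0, 1)" for i i'
  proof -
    have "i \<in> {0, 1, 2, 3}" "i' \<in> {0, 1, 2, 3}"
      using that(1,2) by auto
    with that(3) show ?thesis
      by (auto simp: Let_def)
  qed
  have distinct: "distinct S"
    unfolding distinct_conv_nth S(1) using inj act_eq by blast
  have inv: "inv\<^bsub>G\<^esub> (S ! i) = S ! i'" "inv\<^bsub>G\<^esub> (S ! i') = S ! i" if "(i, i') \<in> {(0, 1), (2, 3)}" for i i'
  proof -
    have less: "i < 4" "i' < 4" "S ! i \<in> carrier G" "S ! i' \<in> carrier G"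
      using that S by (auto intro!: subsetD[OF S(2)] nth_mem)
    \<comment> \<open>Generators 1 and 3 undo generators 0 and 2 in every copy, so symmetry of the
      marking holds for each \<open>J\<close>.\<close>
    have "[(i, True)] \<otimes>\<^bsub>?F\<^esub> [(i', True)] \<in> act_kernel J"
    proof -
      have "word_act j ([(i, True)] \<otimes>\<^bsub>?F\<^esub> [(i', True)]) s = s" for j s
        unfolding word_act_mult using that by (cases s) (auto simp: Let_def)
      moreover have "[(i, True)] \<otimes>\<^bsub>?F\<^esub> [(i', True)] \<in> carrier ?F"
        using less carr by simp
      ultimately show ?thesis
        unfolding act_kernel_def by blast
    qed
    then have *: "S ! i \<otimes>\<^bsub>G\<^esub> S ! i' = \<one>\<^bsub>G\<^esub>"
      using less carr gens by (auto simp: ker[symmetric] kernel_def)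
    then show "inv\<^bsub>G\<^esub> (S ! i') = S ! i"
      using less by (simp add: H.inv_equality)
    then show "inv\<^bsub>G\<^esub> (S ! i) = S ! i'"
      using less H.inv_inv by metis
  qed
  have set_S: "set S = {S ! 0, S ! 1, S ! 2, S ! 3}"
    unfolding set_conv_nth S(1) by (auto simp: less_Suc_eq numeral_eq_Suc)
  have "m_inv G ` set S = set S"
    unfolding set_S using inv[of 0 1] inv[of 2 3] by auto
  then show ?thesis
    using G S gen distinct by (simp add: marked_group_def)
qed

theorem lemma1p11:
  shows "\<exists>(G :: nat set \<Rightarrow> nat monoid) (S :: nat set \<Rightarrow> nat list).
    (\<forall>J \<subseteq> {1..}. marked_group 4 (G J) (S J)) \<and>
    (\<forall>J J'. J \<subset> J' \<and> J' \<subseteq> {1..} \<longrightarrow>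
      (\<exists>f \<in> marked_hom (G J') (S J') (G J) (S J).
        f ` carrier (G J') = carrier (G J) \<and>
        \<not> amenable ((G J')\<lparr>carrier := kernel (G J') (G J) f\<rparr>))) \<and>
    (\<forall>Js J. J \<subseteq> {1..} \<and> (\<forall>n. Js n \<subseteq> J) \<and> tychonoff_converges Js J \<longrightarrow>
      chabauty_converges 4 (\<lambda>n. G (Js n)) (\<lambda>n. S (Js n)) (G J) (S J))"
proof -
  let ?F = "free_group 4"
  obtain G :: "nat set \<Rightarrow> nat monoid" and S where
    G: "\<And>J. group (G J)" and S: "\<And>J. length (S J) = 4" "\<And>J. set (S J) \<subseteq> carrier (G J)"
    and gen: "\<And>J. generate (G J) (set (S J)) = carrier (G J)"
    and ker: "\<And>J. kernel ?F (G J) (marking_map (G J) (S J)) = act_kernel J"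
    using nat_marked_quotient_exists[OF normal_act_kernel] by metis
  have hom: "group_hom ?F (G J) (marking_map (G J) (S J))" for J
    using marking_map_hom[OF G S(2), of J] S(1)[of J]
    by (simp add: group_hom_def group_hom_axioms_def group_free_group G)
  have onto: "marking_map (G J) (S J) ` carrier ?F = carrier (G J)" for J
    using marking_map_image[OF G S(2) gen, of J] S(1) by simp
  have marked: "marked_group 4 (G J) (S J)" for J
    using marked_group_act_kernel[OF G S gen ker] .
  have mono: "\<exists>f \<in> marked_hom (G J') (S J') (G J) (S J).
      f ` carrier (G J') = carrier (G J) \<and>
      \<not> amenable ((G J')\<lparr>carrier := kernel (G J') (G J) f\<rparr>)"
    if J: "J \<subset> J'" "J' \<subseteq> {1..}" for J J'
  proof -
    have "act_kernel J' \<subseteq> act_kernel J"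
      using J(1) by (auto simp: act_kernel_def)
    then obtain f where f: "f \<in> hom (G J') (G J)"
      "\<And>w. w \<in> carrier ?F \<Longrightarrow> f (marking_map (G J') (S J') w) = marking_map (G J) (S J) w"
      "f ` carrier (G J') = carrier (G J)"
      "kernel (G J') (G J) f = marking_map (G J') (S J') ` act_kernel J"
      using hom_factor_through_surjection[OF hom onto hom onto, of J' J] unfolding ker by metis
    have "f (S J' ! i) = S J ! i" if "i < 4" for i
    proof -
      have "[(i, True)] \<in> carrier ?F"
        using that by (simp add: free_group_def)
      from f(2)[OF this] show ?thesis
        using that S(1) marking_map_generator[OF G S(2)] by metis
    qed
    then have "map f (S J') = S J"
      using S(1) by (simp add: list_eq_iff_nth_eq)
    \<comment> \<open>Positivity of \<open>n\<close> matters, since copy \<open>0\<close> is present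
      in both groups.\<close>
    moreover obtain n where "n \<in> J'" "n \<notin> J" "0 < n"
      using J by force
    ultimately show ?thesis
      using f not_amenable_image_act_kernel[OF hom ker] by (auto simp: marked_hom_def)
  qed
  have continuous: "chabauty_converges 4 (\<lambda>n. G (Js n)) (\<lambda>n. S (Js n)) (G J) (S J)"
    if "tychonoff_converges Js J" for Js J
    unfolding chabauty_converges_def ker
  proof
    fix r
    have "\<forall>\<^sub>F n in sequentially. Js n \<inter> {1..2 * r} = J \<inter> {1..2 * r}"
      using that tychonoff_converges_iff by blast
    then show "\<forall>\<^sub>F n in sequentially.
        act_kernel (Js n) \<inter> free_ball 4 r = act_kernel J \<inter> free_ball 4 r"
      by eventually_elim (use act_kernel_inter_ball in blast)
  qed
  show ?thesis
    by (intro exI[of _ G] exI[of _ S] conjI allI impI marked; elim conjE)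
      (simp_all add: mono continuous)
qed

end
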